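(* Let $f,g:\mathbb{R}^n\to\mathbb{R}$ be convex, $F=f+g$, and assume that $f$ is differentiable and that $\nabla f$ is Lipschitz continuous with Lipschitz constant $L(f)>0$. Let $x^*$ be an optimal solution of $\min_{x\in\mathbb{R}^n}F(x)$. Let $\alpha=\sqrt2-1$ and, for a run of the algorithm FALM-S (described in the context), let $r(k)$ be the number of regular steps among the first $k$ steps (steps $1,\dots,k$). If $0<\mu\le1/L(f)$, then the sequence $\{y^k\}$ generated by FALM-S satisfies $$F(y^k)-F(x^* )\le\frac{2\|x^0-x^*\|^2}{\mu\,(k+1+\alpha\,\hat r(k))^2}\qquad\text{for all }k\ge1,$$ where $\hat r(k)=r(k)$ if the first step is a skipping step and $\hat r(k)=r(k)+1$ if the first step is a regular step. Hence $\{F(y^k)\}$ converges to $F(x^* )$. Moreover, if $1/(\beta L(f))\le\mu\le1/L(f)$ for some $\beta\ge1$, then for every $\epsilon>0$ the number of iterations required by FALM-S to get an $\epsilon$-optimal solution is at most $\lfloor\sqrt{C/\epsilon}\rfloor$, where $C=2\beta L(f)\|x^0-x^*\|^2$; that is, $F(y^k)-F(x^* )\le\epsilon$ for every $k\ge1$ with $k\ge\lfloor\sqrt{C/\epsilon}\rfloor$.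
   Context: $\|\cdot\|$ is the Euclidean norm. For $\mu>0$ define $$\mathcal{L}_\mu(x,y;\lambda):=f(x)+g(y)-\langle\lambda,x-y\rangle+\tfrac{1}{2\mu}\|x-y\|^2,$$ $$Q_f(u,v):=g(u)+f(v)+\langle\nabla f(v),u-v\rangle+\tfrac{1}{2\mu}\|u-v\|^2 .$$ A point $x_\epsilon$ is $\epsilon$-optimal if $F(x_\epsilon)-F(x^* )\le\epsilon$. Algorithm FALM-S (fast alternating linearization method with skipping steps). Choose $\mu>0$, $x^0=y^0=z^1\in\mathbb{R}^n$, $\lambda^1\in-\partial g(z^1)$, and set $t_1=1$. For $k=1,2,\dots$: 1. $x^k:=\arg\min_x\mathcal{L}_\mu(x,z^k;\lambda^k)$. 2. If $F(x^k)>\mathcal{L}_\mu(x^k,z^k;\lambda^k)$, the $x$-step is skipped and iteration $k$ is called a skipping step. In that case, if $k\ge2$, reset $t_k:=\big(1+\sqrt{1+8t_{k-1}^2}\big)/2$ if iteration $k-1$ was not a skipping step, and $t_k:=\big(1+\sqrt{1+4t_{k-1}^2}\big)/2$ if iteration $k-1$ was a skipping step; then reset $z^k:=y^{k-1}+\frac{t_{k-1}-1}{t_k}(y^{k-1}-y^{k-2})$ and $x^k:=z^k$. If $k=1$, leave $t_1=1$ and $z^1$ unchanged and set $x^1:=z^1$. If the displayed inequality does not hold, iteration $k$ is called a regular step. 3. $y^k:=\arg\min_y Q_f(y,x^k)$. 4. $t_{k+1}:=\big(1+\sqrt{1+2t_k^2}\big)/2$ if iteration $k$ is a skipping step, and $t_{k+1}:=\big(1+\sqrt{1+4t_k^2}\big)/2$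 if iteration $k$ is a regular step. 5. $z^{k+1}:=y^k+\frac{t_k-1}{t_{k+1}}(y^k-y^{k-1})$. 6. Choose $\lambda^{k+1}\in-\partial g(z^{k+1})$. *)

theory Defs
  imports "HOL-Analysis.Analysis"
begin

definition grad :: "('a::real_inner \<Rightarrow> real) \<Rightarrow> 'a \<Rightarrow> 'a" where
  "grad f x = (THE D. GDERIV f x :> D)"

lemma grad_eqI:
  assumes "GDERIV f x :> D"
  shows "grad f x = D"
  unfolding grad_def
proof (rule the_equality)
  fix D' assume "GDERIV f x :> D'"
  then have "(\<lambda>h. h \<bullet> D') = (\<lambda>h. h \<bullet> D)"
    using assms unfolding gderiv_def by (rule has_derivative_unique)
  then have "\<forall>h. h \<bullet> D' = h \<bullet> D"
    by (simp add: fun_eq_iff)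
  then show "D' = D"
    by (rule iffD1[OF vector_eq_ldot])
qed (rule assms)

lemma GDERIV_grad:
  fixes f :: "'a::euclidean_space \<Rightarrow> real"
  assumes "f differentiable (at x)"
  shows "GDERIV f x :> grad f x"
proof -
  obtain f' where f': "(f has_derivative f') (at x)"
    using assms unfolding differentiable_def by blast
  then have "linear f'"
    by (rule has_derivative_linear)
  have "f' h = h \<bullet> (\<Sum>b\<in>Basis. f' b *\<^sub>R b)" for h
  proof -
    have "f' h = f' (\<Sum>b\<in>Basis. (h \<bullet> b) *\<^sub>R b)"
      by (simp only: euclidean_representation)
    also have "\<dots> = (\<Sum>b\<in>Basis. (h \<bullet> b) * f' b)"
      by (simp only: linear_sum[OF \<open>linear f'\<close>] linear_scale[OF \<open>linear f'\<close>] real_scaleR_def)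
    also have "\<dots> = h \<bullet> (\<Sum>b\<in>Basis. f' b *\<^sub>R b)"
      by (simp only: inner_sum_right inner_scaleR_right mult.commute)
    finally show ?thesis .
  qed
  then have "f' = (\<lambda>h. h \<bullet> (\<Sum>b\<in>Basis. f' b *\<^sub>R b))"
    by (rule ext)
  then have D: "GDERIV f x :> (\<Sum>b\<in>Basis. f' b *\<^sub>R b)"
    unfolding gderiv_def by (rule subst) (rule f')
  show ?thesis
    unfolding grad_eqI[OF D] by (rule D)
qed

definition subdifferential :: "('a::real_inner \<Rightarrow> real) \<Rightarrow> 'a \<Rightarrow> 'a set" where
  "subdifferential g z = {s. \<forall>u. g z + s \<bullet> (u - z) \<le> g u}"

definition aug_lagrangian ::
  "('a::real_inner \<Rightarrow> real) \<Rightarrow> ('a \<Rightarrow> real) \<Rightarrow> real \<Rightarrow> 'a \<Rightarrow> 'a \<Rightarrow> 'a \<Rightarrow> real" where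
  "aug_lagrangian f g \<mu> x y l =
     f x + g y - l \<bullet> (x - y) + 1 / (2 * \<mu>) * (norm (x - y))\<^sup>2"

definition Q_model ::
  "('a::real_inner \<Rightarrow> real) \<Rightarrow> ('a \<Rightarrow> real) \<Rightarrow> real \<Rightarrow> 'a \<Rightarrow> 'a \<Rightarrow> real" where
  "Q_model f g \<mu> u v =
     g u + f v + grad f v \<bullet> (u - v) + 1 / (2 * \<mu>) * (norm (u - v))\<^sup>2"

abbreviation minimizer :: "('a \<Rightarrow> real) \<Rightarrow> 'a \<Rightarrow> bool" where
  "minimizer h \<equiv> is_arg_min h (\<lambda>_. True)"

(* A run of FALM-S as a family of sequences. The algorithm overwrites t_k, z^k and x^k in
   step 2 of a skipping iteration: the primed sequences hold the values before step 2, the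
   unprimed ones the final values, which all later steps refer to. The multiplier l k is a
   negative subgradient at the value z' k before the possible overwriting.
   skip k says that iteration k is a skipping step. Iterations are numbered from 1; index 0
   is used only for x 0 and y 0, and the remaining values at 0 are irrelevant. *)
definition falm_s_run ::
  "('a::real_inner \<Rightarrow> real) \<Rightarrow> ('a \<Rightarrow> real) \<Rightarrow> real \<Rightarrow>
   (nat \<Rightarrow> real) \<Rightarrow> (nat \<Rightarrow> 'a) \<Rightarrow> (nat \<Rightarrow> 'a) \<Rightarrow> (nat \<Rightarrow> 'a) \<Rightarrow> (nat \<Rightarrow> bool) \<Rightarrow>
   (nat \<Rightarrow> real) \<Rightarrow> (nat \<Rightarrow> 'a) \<Rightarrow> (nat \<Rightarrow> 'a) \<Rightarrow> (nat \<Rightarrow> 'a) \<Rightarrow> bool" where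
  "falm_s_run f g \<mu> t' z' l x' skip t z x y \<longleftrightarrow>
     x 0 = y 0 \<and> y 0 = z' 1 \<and> l 1 \<in> uminus ` subdifferential g (z' 1) \<and> t' 1 = 1 \<and>
     (\<forall>k\<ge>1.
        minimizer (\<lambda>u. aug_lagrangian f g \<mu> u (z' k) (l k)) (x' k) \<and>
        (skip k \<longleftrightarrow> f (x' k) + g (x' k) > aug_lagrangian f g \<mu> (x' k) (z' k) (l k)) \<and>
        (\<not> skip k \<longrightarrow> t k = t' k \<and> z k = z' k \<and> x k = x' k) \<and>
        (skip k \<and> k = 1 \<longrightarrow> t k = t' k \<and> z k = z' k \<and> x k = z k) \<and>
        (skip k \<and> k \<ge> 2 \<longrightarrow>
           t k = (1 + sqrt (1 + (if skip (k - 1) then 4 else 8) * (t (k - 1))\<^sup>2)) / 2 \<and>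
           z k = y (k - 1) + ((t (k - 1) - 1) / t k) *\<^sub>R (y (k - 1) - y (k - 2)) \<and>
           x k = z k) \<and>
        minimizer (\<lambda>u. Q_model f g \<mu> u (x k)) (y k) \<and>
        t' (k + 1) = (1 + sqrt (1 + (if skip k then 2 else 4) * (t k)\<^sup>2)) / 2 \<and>
        z' (k + 1) = y k + ((t k - 1) / t' (k + 1)) *\<^sub>R (y k - y (k - 1)) \<and>
        l (k + 1) \<in> uminus ` subdifferential g (z' (k + 1)))"

definition num_regular :: "(nat \<Rightarrow> bool) \<Rightarrow> nat \<Rightarrow> nat" where
  "num_regular skip k = card {j \<in> {1..k}. \<not> skip j}"

definition r_hat :: "(nat \<Rightarrow> bool) \<Rightarrow> nat \<Rightarrow> nat" where
  "r_hat skip k = (if skip 1 then num_regular skip k else num_regular skip k + 1)"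

end

theory Submission
  imports Defs
begin

text \<open>
  Put c_k = 1 if iteration k is a skipping step and c_k = 2 if it is a regular step. Since each
  of the two proximal subproblems has a strongly convex objective, iteration k satisfies
  2 \<mu> c_k (F u - F (y k)) \<ge> |y k - u|^2 - |z k - u|^2 for every u: a regular step adds up one such
  inequality from the x-step and one from the y-step, a skipping step has only the latter.
  The update rules for t are exactly those for which
  c_k t_k (t_k - 1) = c_(k-1) t_(k-1)^2, so that, as for FISTA,
  2 \<mu> c_k t_k^2 (F (y k) - F x*) + |t_k y_k - (t_k - 1) y_(k-1) - x*|^2 is nonincreasing.
  Finally (sqrt c_k) t_k increases by at least (sqrt c_k) / 2 in each iteration.
\<close>

section \<open>First-order bounds for smooth and convex functions\<close>

lemma descent_lemma:
  fixes f :: "'a::euclidean_space \<Rightarrow> real"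
  assumes f_diff: "\<And>u. f differentiable (at u)"
    and lip: "L-lipschitz_on UNIV (grad f)"
  shows "f u \<le> f v + grad f v \<bullet> (u - v) + L / 2 * (norm (u - v))\<^sup>2"
proof -
  define d where "d = u - v"
  \<comment> \<open>\<open>\<phi>\<close> is \<open>f\<close> along the ray from \<open>v\<close>
    through \<open>u\<close>, minus the growth that the bound allows. The claim is
    \<open>\<phi> 1 \<le> \<phi> 0\<close>, so a nonpositive derivative on [0,1] suffices; the
    Lipschitz estimate supplies it.\<close>
  define \<phi> where "\<phi> s = f (v + s *\<^sub>R d) - s * (grad f v \<bullet> d) - L / 2 * s\<^sup>2 * (norm d)\<^sup>2" for s
  have D: "\<exists>D. DERIV \<phi> s :> D \<and> D \<le> 0" if "0 \<le> s" for s
  proof (intro exI conjI)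
    have "(f has_derivative (\<lambda>h. h \<bullet> grad f (v + s *\<^sub>R d))) (at (v + s *\<^sub>R d))"
      using GDERIV_grad[OF f_diff] unfolding gderiv_def .
    moreover have "((\<lambda>s. v + s *\<^sub>R d) has_derivative (\<lambda>h. h *\<^sub>R d)) (at s)"
      by (auto intro!: derivative_eq_intros)
    ultimately have "((\<lambda>s. f (v + s *\<^sub>R d)) has_derivative (\<lambda>h. h *\<^sub>R d \<bullet> grad f (v + s *\<^sub>R d))) (at s)"
      by (rule has_derivative_compose[rotated])
    then have "((\<lambda>s. f (v + s *\<^sub>R d)) has_real_derivative d \<bullet> grad f (v + s *\<^sub>R d)) (at s)"
      by (simp add: has_field_derivative_def mult.commute[of _ "d \<bullet> _"])
    then show "DERIV \<phi> s :> d \<bullet> grad f (v + s *\<^sub>R d) - grad f v \<bullet> d - L * s * (norm d)\<^sup>2"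
      unfolding \<phi>_def by (auto intro!: derivative_eq_intros)
    have "d \<bullet> grad f (v + s *\<^sub>R d) - grad f v \<bullet> d = (grad f (v + s *\<^sub>R d) - grad f v) \<bullet> d"
      by (simp add: inner_diff_left inner_commute[of d])
    also have "\<dots> \<le> norm (grad f (v + s *\<^sub>R d) - grad f v) * norm d"
      by (rule norm_cauchy_schwarz)
    also have "\<dots> \<le> (L * norm (s *\<^sub>R d)) * norm d"
      using lipschitz_onD[OF lip, of "v + s *\<^sub>R d" v]
      by (intro mult_right_mono) (auto simp: dist_norm)
    also have "\<dots> = L * s * (norm d)\<^sup>2"
      using that by (simp add: power2_eq_square)
    finally show "d \<bullet> grad f (v + s *\<^sub>R d) - grad f v \<bullet> d - L * s * (norm d)\<^sup>2 \<le> 0"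
      by simp
  qed
  have "\<phi> 1 \<le> \<phi> 0"
    by (rule DERIV_nonpos_imp_nonincreasing) (use D in simp_all)
  then show ?thesis
    by (simp add: \<phi>_def d_def algebra_simps)
qed

text \<open>Restricting \<open>f\<close> to the line through \<open>v\<close> and \<open>u\<close>
  reduces this to the tangent inequality for a convex function of one real variable, at 0 and
  evaluated at 1.\<close>

lemma convex_above_tangent_grad:
  fixes f :: "'a::euclidean_space \<Rightarrow> real"
  assumes f_diff: "f differentiable (at v)" and conv: "convex_on UNIV f"
  shows "f v + grad f v \<bullet> (u - v) \<le> f u"
proof -
  define d where "d = u - v"
  define \<phi> where "\<phi> s = f (v + s *\<^sub>R d)" for s :: real
  have "(f has_derivative (\<lambda>h. h \<bullet> grad f v)) (at (v + 0 *\<^sub>R d))"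
    using GDERIV_grad[OF f_diff] unfolding gderiv_def by simp
  moreover have "((\<lambda>s. v + s *\<^sub>R d) has_derivative (\<lambda>h. h *\<^sub>R d)) (at 0)"
    by (auto intro!: derivative_eq_intros)
  ultimately have "(\<phi> has_derivative (\<lambda>h. h *\<^sub>R d \<bullet> grad f v)) (at 0)"
    unfolding \<phi>_def by (rule has_derivative_compose[rotated])
  then have D: "(\<phi> has_real_derivative d \<bullet> grad f v) (at 0 within UNIV)"
    by (simp add: has_field_derivative_def mult.commute[of _ "d \<bullet> _"])
  have "convex_on UNIV \<phi>"
  proof (rule convex_onI)
    fix r a b :: real
    assume "0 < r" "r < 1"
    have "v + ((1 - r) * a + r * b) *\<^sub>R d = (1 - r) *\<^sub>R (v + a *\<^sub>R d) + r *\<^sub>R (v + b *\<^sub>R d)"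
      by (simp add: algebra_simps)
    then show "\<phi> ((1 - r) *\<^sub>R a + r *\<^sub>R b) \<le> (1 - r) * \<phi> a + r * \<phi> b"
      using convex_onD[OF conv, of r "v + a *\<^sub>R d" "v + b *\<^sub>R d"] \<open>0 < r\<close> \<open>r < 1\<close>
      by (simp add: \<phi>_def)
  qed simp
  from convex_on_imp_above_tangent[OF this _ _ _ D, of 1] show ?thesis
    by (simp add: \<phi>_def d_def inner_commute)
qed

section \<open>Quadratic growth of a proximal objective around its minimizer\<close>

lemma norm_convex_combination:
  fixes y u v :: "'a::real_inner"
  shows "(norm ((1 - r) *\<^sub>R (y - v) + r *\<^sub>R (u - v)))\<^sup>2
    = (1 - r) * (norm (y - v))\<^sup>2 + r * (norm (u - v))\<^sup>2 - r * (1 - r) * (norm (u - y))\<^sup>2"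
proof -
  define a b where "a = y - v" and "b = u - v"
  have "u - y = b - a"
    by (simp add: a_def b_def)
  then show ?thesis
    unfolding a_def[symmetric] b_def[symmetric] power2_norm_eq_inner
    by (simp add: inner_add_left inner_add_right inner_diff_left inner_diff_right inner_commute[of b a])
       (simp add: algebra_simps)
qed

text \<open>The quadratic term makes the objective strongly convex, which yields the extra
  \<open>c * (norm (u - y))\<^sup>2\<close>. The argument avoids subgradients of \<open>p\<close>:
  \<open>y\<close> is compared with the points of the segment from \<open>y\<close> to
  \<open>u\<close>.\<close>

lemma minimizer_prox_strong:
  fixes p :: "'a::real_inner \<Rightarrow> real"
  assumes conv: "convex_on UNIV p" and c: "0 \<le> c"
    and min: "minimizer (\<lambda>u. p u + c * (norm (u - v))\<^sup>2) y"
  shows "p y + c * (norm (y - v))\<^sup>2 + c * (norm (u - y))\<^sup>2 \<le> p u + c * (norm (u - v))\<^sup>2"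
proof -
  define h where "h u = p u + c * (norm (u - v))\<^sup>2" for u
  have *: "h y + (1 - r) * (c * (norm (u - y))\<^sup>2) \<le> h u" if r: "0 < r" "r < 1" for r
  proof -
    define w where "w = (1 - r) *\<^sub>R y + r *\<^sub>R u"
    have "h y \<le> h w"
      using min by (auto simp: is_arg_min_def h_def not_less)
    also have "\<dots> \<le> (1 - r) * p y + r * p u + c * (norm (w - v))\<^sup>2"
      using convex_onD[OF conv, of r y u] r by (simp add: h_def w_def)
    also have "(norm (w - v))\<^sup>2
        = (1 - r) * (norm (y - v))\<^sup>2 + r * (norm (u - v))\<^sup>2 - r * (1 - r) * (norm (u - y))\<^sup>2"
    proof -
      have "w - v = (1 - r) *\<^sub>R (y - v) + r *\<^sub>R (u - v)"
        by (simp add: w_def algebra_simps)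
      then show ?thesis
        by (simp add: norm_convex_combination)
    qed
    finally have "r * (h y + (1 - r) * (c * (norm (u - y))\<^sup>2)) \<le> r * h u"
      by (simp add: h_def algebra_simps)
    then show ?thesis
      using r by simp
  qed
  \<comment> \<open>Dividing the comparison by \<open>r\<close> left the factor \<open>1 - r\<close>
    on the growth term; letting the point approach \<open>y\<close> (\<open>r\<close> to 0 from the
    right) removes it.\<close>
  have "((\<lambda>r. h y + (1 - r) * (c * (norm (u - y))\<^sup>2)) \<longlongrightarrow> h y + (1 - 0) * (c * (norm (u - y))\<^sup>2))
      (at_right (0::real))"
    by (intro tendsto_intros)
  moreover have "\<forall>\<^sub>F r in at_right 0. h y + (1 - r) * (c * (norm (u - y))\<^sup>2) \<le> h u"
    by (auto simp: eventually_at_right_field intro!: exI[of _ 1] *)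
  ultimately have "h y + (1 - 0) * (c * (norm (u - y))\<^sup>2) \<le> h u"
    by (intro tendsto_upperbound) auto
  then show ?thesis
    by (simp add: h_def)
qed

section \<open>Descent inequalities of the two subproblems\<close>

lemma prox_gradient_step:
  fixes f g :: "'a::euclidean_space \<Rightarrow> real"
  assumes f_convex: "convex_on UNIV f" and g_convex: "convex_on UNIV g"
    and f_diff: "\<And>u. f differentiable (at u)"
    and lip: "L-lipschitz_on UNIV (grad f)"
    and \<mu>: "0 < \<mu>" "L * \<mu> \<le> 1"
    and min: "minimizer (\<lambda>u. Q_model f g \<mu> u v) y"
  shows "(norm (y - u))\<^sup>2 - (norm (v - u))\<^sup>2 \<le> 2 * \<mu> * ((f u + g u) - (f y + g y))"
proof -
  define c where "c = 1 / (2 * \<mu>)"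
  \<comment> \<open>\<open>p\<close> is the model with only \<open>f\<close> linearized. Convexity
    of \<open>f\<close> puts \<open>p\<close> below the objective at \<open>u\<close>; the descent
    lemma and \<open>L / 2 \<le> c\<close> put \<open>p\<close> plus the proximal term above the
    objective at \<open>y\<close>.\<close>
  define p where "p u = g u + (f v + grad f v \<bullet> (u - v))" for u
  have "convex_on UNIV (\<lambda>u. f v + grad f v \<bullet> (u - v))"
    by (rule convex_onI) (auto simp: algebra_simps)
  from convex_on_add[OF g_convex this] have "convex_on UNIV p"
    unfolding p_def .
  moreover have "0 \<le> c" "L / 2 \<le> c"
    using \<mu> by (simp_all add: c_def field_simps)
  moreover have "Q_model f g \<mu> u v = p u + c * (norm (u - v))\<^sup>2" for u
    by (simp add: Q_model_def p_def c_def)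
  ultimately have "p y + c * (norm (y - v))\<^sup>2 + c * (norm (u - y))\<^sup>2 \<le> p u + c * (norm (u - v))\<^sup>2"
    using min by (intro minimizer_prox_strong) auto
  moreover have "p u \<le> f u + g u"
    using convex_above_tangent_grad[OF f_diff f_convex, of v u] by (simp add: p_def)
  moreover have "f y + g y \<le> p y + c * (norm (y - v))\<^sup>2"
    using descent_lemma[OF f_diff lip, of y v]
      mult_right_mono[OF \<open>L / 2 \<le> c\<close>, of "(norm (y - v))\<^sup>2"]
    by (simp add: p_def)
  ultimately have "c * ((norm (u - y))\<^sup>2 - (norm (u - v))\<^sup>2) \<le> (f u + g u) - (f y + g y)"
    by (simp add: algebra_simps)
  then show ?thesis
    using \<mu>(1) by (simp add: c_def field_simps norm_minus_commute)
qed

text \<open>The mirror image of \<open>prox_gradient_step\<close>: now \<open>g\<close> is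
  linearized at \<open>z\<close>, by the subgradient \<open>- l\<close>. The test for a regular step
  is exactly the upper bound at the new point, and takes the place of the descent lemma.\<close>

lemma alternating_linearization_step:
  fixes f g :: "'a::euclidean_space \<Rightarrow> real"
  assumes f_convex: "convex_on UNIV f"
    and \<mu>: "0 < \<mu>"
    and l: "l \<in> uminus ` subdifferential g z"
    and min: "minimizer (\<lambda>u. aug_lagrangian f g \<mu> u z l) x"
    and regular: "f x + g x \<le> aug_lagrangian f g \<mu> x z l"
  shows "(norm (x - u))\<^sup>2 - (norm (z - u))\<^sup>2 \<le> 2 * \<mu> * ((f u + g u) - (f x + g x))"
proof -
  define c where "c = 1 / (2 * \<mu>)"
  define p where "p u = f u + (g z - l \<bullet> (u - z))" for u
  have "convex_on UNIV (\<lambda>u. g z - l \<bullet> (u - z))"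
    by (rule convex_onI) (auto simp: algebra_simps)
  from convex_on_add[OF f_convex this] have "convex_on UNIV p"
    unfolding p_def .
  moreover have "0 \<le> c"
    using \<mu> by (simp add: c_def)
  moreover have eq: "aug_lagrangian f g \<mu> u z l = p u + c * (norm (u - z))\<^sup>2" for u
    by (simp add: aug_lagrangian_def p_def c_def)
  ultimately have "p x + c * (norm (x - z))\<^sup>2 + c * (norm (u - x))\<^sup>2 \<le> p u + c * (norm (u - z))\<^sup>2"
    using min by (intro minimizer_prox_strong) auto
  moreover have "p u \<le> f u + g u"
    using l by (auto simp: subdifferential_def p_def)
  ultimately have "c * ((norm (u - x))\<^sup>2 - (norm (u - z))\<^sup>2) \<le> (f u + g u) - (f x + g x)"
    using regular by (simp add: eq algebra_simps)
  then show ?thesis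
    using \<mu> by (simp add: c_def field_simps norm_minus_commute)
qed

section \<open>Algebra of the momentum parameters and step weights\<close>

lemma extrapolation_identity:
  fixes y z u w :: "'a::real_inner"
  shows "t * (t - 1) * ((norm (y - u))\<^sup>2 - (norm (z - u))\<^sup>2) + t * ((norm (y - w))\<^sup>2 - (norm (z - w))\<^sup>2)
    = (norm (t *\<^sub>R y - (t - 1) *\<^sub>R u - w))\<^sup>2 - (norm (t *\<^sub>R z - (t - 1) *\<^sub>R u - w))\<^sup>2"
  \<comment> \<open>As functions of \<open>y\<close>, the weighted squared distances to
    \<open>u\<close> and \<open>w\<close> and the single square on the right have the same quadratic
    and linear parts. Their constant difference cancels against the same expression in
    \<open>z\<close>.\<close>
  by (simp add: power2_norm_eq_inner inner_diff_left inner_diff_right inner_commute)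
     (simp add: algebra_simps)

text \<open>Every update of \<open>t\<close> after the first value has this form, with
  \<open>q\<close> a positive multiple of the previous \<open>t\<close> squared; \<open>t\<close> is
  the larger root of the quadratic.\<close>

lemma momentum_quadratic:
  fixes q t :: real
  assumes "t = (1 + sqrt (1 + 4 * q)) / 2" and "0 \<le> q"
  shows "t * (t - 1) = q" and "1 \<le> t"
proof -
  have "(sqrt (1 + 4 * q))\<^sup>2 = 1 + 4 * q" "1 \<le> sqrt (1 + 4 * q)"
    using assms(2) by auto
  then show "t * (t - 1) = q" "1 \<le> t"
    unfolding assms(1) by (simp_all add: power2_eq_square field_simps)
qed

lemma num_regular_Suc: "num_regular skip (Suc k) = num_regular skip k + (if skip (Suc k) then 0 else 1)"
proof -
  have "{j \<in> {1..Suc k}. \<not> skip j} =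
      (if skip (Suc k) then {j \<in> {1..k}. \<not> skip j} else insert (Suc k) {j \<in> {1..k}. \<not> skip j})"
    by (auto simp: le_Suc_eq)
  then show ?thesis
    by (simp add: num_regular_def)
qed

text \<open>This is \<open>c_k\<close>, the number of proximal inequalities that iteration
  \<open>k\<close> contributes.\<close>

definition step_weight :: "(nat \<Rightarrow> bool) \<Rightarrow> nat \<Rightarrow> real" where
  "step_weight skip k = (if skip k then 1 else 2)"

text \<open>The origin of the constant \<open>sqrt 2 - 1\<close> in the rate: it is the surplus of a
  regular step over a skipping step.\<close>

lemma sqrt_step_weight: "sqrt (step_weight skip k) = 1 + (sqrt 2 - 1) * (if skip k then 0 else 1)"
  by (simp add: step_weight_def)

section \<open>Parameters along a run\<close>

context
  fixes f g :: "'a::euclidean_space \<Rightarrow> real" and \<mu> :: real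
    and t' z' l x' skip t z x y
  assumes run: "falm_s_run f g \<mu> t' z' l x' skip t z x y"
begin

lemma falm_s_multiplier:
  assumes "k \<ge> 1"
  shows "l k \<in> uminus ` subdifferential g (z' k)"
proof (cases "k = 1")
  case True
  then show ?thesis
    using run unfolding falm_s_run_def by blast
next
  case False
  then obtain j where "k = j + 1" "j \<ge> 1"
    using assms by (intro that[of "k - 1"]) auto
  then show ?thesis
    using run unfolding falm_s_run_def by blast
qed

lemma falm_s_first: "t 1 = 1" "z 1 = x 0"
proof -
  have "t' 1 = 1" "z' 1 = x 0" "t 1 = t' 1 \<and> z 1 = z' 1"
    using run unfolding falm_s_run_def by (simp, simp, auto dest!: spec[of _ "1 :: nat"])
  then show "t 1 = 1" "z 1 = x 0"
    by simp_all
qed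

text \<open>The provisional \<open>t'\<close> presumes that the next iteration is regular; the reset
  in a skipping step corrects it for weight 1. In all four cases the coefficient under the root is
  therefore 4 times the ratio of consecutive weights.\<close>

lemma falm_s_momentum:
  assumes "k \<ge> 1"
  shows "t (Suc k) = (1 + sqrt (1 + 4 * (step_weight skip k / step_weight skip (Suc k) * (t k)\<^sup>2))) / 2"
    and "z (Suc k) = y k + ((t k - 1) / t (Suc k)) *\<^sub>R (y k - y (k - 1))"
proof -
  have regular: "t (Suc k) = t' (Suc k)" "z (Suc k) = z' (Suc k)" if "\<not> skip (Suc k)"
    using run that unfolding falm_s_run_def by simp_all
  have skipping: "t (Suc k) = (1 + sqrt (1 + (if skip k then 4 else 8) * (t k)\<^sup>2)) / 2"
      "z (Suc k) = y k + ((t k - 1) / t (Suc k)) *\<^sub>R (y k - y (k - 1))" if "skip (Suc k)"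
    using run assms that unfolding falm_s_run_def by (auto dest!: spec[of _ "Suc k"])
  have next_iterate: "t' (Suc k) = (1 + sqrt (1 + (if skip k then 2 else 4) * (t k)\<^sup>2)) / 2"
      "z' (Suc k) = y k + ((t k - 1) / t' (Suc k)) *\<^sub>R (y k - y (k - 1))"
    using run assms unfolding falm_s_run_def by simp_all
  show "z (Suc k) = y k + ((t k - 1) / t (Suc k)) *\<^sub>R (y k - y (k - 1))"
    using regular skipping(2) next_iterate(2) by metis
  have "4 * (step_weight skip k / step_weight skip (Suc k) * (t k)\<^sup>2) =
      (if skip (Suc k) then if skip k then 4 else 8 else if skip k then 2 else 4) * (t k)\<^sup>2"
    by (simp add: step_weight_def)
  then show "t (Suc k) = (1 + sqrt (1 + 4 * (step_weight skip k / step_weight skip (Suc k) * (t k)\<^sup>2))) / 2"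
    by (cases "skip (Suc k)") (simp_all only: regular(1) skipping(1) next_iterate(1) if_True if_False not_False_eq_True)
qed

lemma falm_s_t_ge_1: "k \<ge> 1 \<Longrightarrow> 1 \<le> t k"
proof (induction k rule: nat_induct_at_least)
  case (Suc k)
  show ?case
    by (rule momentum_quadratic(2)[OF falm_s_momentum(1)[OF Suc.hyps]]) (simp add: step_weight_def)
qed (simp add: falm_s_first(1)[simplified])

lemma falm_s_weight_recursion:
  assumes "k \<ge> 1"
  shows "step_weight skip (Suc k) * (t (Suc k) * (t (Suc k) - 1)) = step_weight skip k * (t k)\<^sup>2"
  by (subst momentum_quadratic(1)[OF falm_s_momentum(1)[OF assms]]) (simp_all add: step_weight_def)

lemma falm_s_t_lower_bound:
  "k \<ge> 1 \<Longrightarrow> real k + 1 + (sqrt 2 - 1) * real (r_hat skip k) \<le> 2 * (sqrt (step_weight skip k) * t k)"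
proof (induction k rule: nat_induct_at_least)
  \<comment> \<open>Equality holds here: both sides are 2 after a skipping first step and
    \<open>2 * sqrt 2\<close> after a regular one. The extra 1 in \<open>r_hat\<close> for a regular
    first step records this head start.\<close>
  case base
  show ?case
    using falm_s_first(1) num_regular_Suc[of skip 0]
    by (auto simp: r_hat_def step_weight_def num_regular_def)
next
  case (Suc k)
  let ?c = "step_weight skip (Suc k)" and ?s = "sqrt (step_weight skip k) * t k"
  let ?s' = "sqrt ?c * t (Suc k)"
  have "0 \<le> ?c" "0 \<le> step_weight skip k"
    by (simp_all add: step_weight_def)
  then have "?s\<^sup>2 = ?s'\<^sup>2 - sqrt ?c * ?s'"
    using falm_s_weight_recursion[OF Suc.hyps]
    by (simp add: power_mult_distrib power2_eq_square algebra_simps)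
  \<comment> \<open>Completing the square adds \<open>?c / 4\<close>.\<close>
  also have "\<dots> \<le> (?s' - sqrt ?c / 2)\<^sup>2"
    by (simp add: power2_diff)
  finally have "?s \<le> ?s' - sqrt ?c / 2"
  proof (rule power2_le_imp_le)
    \<comment> \<open>The root may be taken because \<open>t (Suc k)\<close> is at least 1, hence
      \<open>?s'\<close> is at least \<open>sqrt ?c\<close>.\<close>
    have "sqrt ?c * 1 \<le> sqrt ?c * t (Suc k)"
      using falm_s_t_ge_1[of "Suc k"] \<open>0 \<le> ?c\<close> by (intro mult_left_mono) auto
    then show "0 \<le> ?s' - sqrt ?c / 2"
      using real_sqrt_ge_zero[OF \<open>0 \<le> ?c\<close>] by linarith
  qed
  then have "2 * ?s + sqrt ?c \<le> 2 * ?s'"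
    by simp
  moreover have "real (r_hat skip (Suc k)) = real (r_hat skip k) + (if skip (Suc k) then 0 else 1)"
    by (simp add: r_hat_def num_regular_Suc)
  ultimately show ?case
    using Suc.IH by (auto simp: sqrt_step_weight algebra_simps)
qed

section \<open>The potential argument and the rate\<close>

context
  fixes L :: real
  assumes f_convex: "convex_on UNIV f" and g_convex: "convex_on UNIV g"
    and f_diff: "\<And>u. f differentiable (at u)"
    and lip: "L-lipschitz_on UNIV (grad f)"
    and \<mu>: "0 < \<mu>" "L * \<mu> \<le> 1"
begin

lemma falm_s_step:
  assumes k: "k \<ge> 1"
  shows "(norm (y k - u))\<^sup>2 - (norm (z k - u))\<^sup>2
    \<le> 2 * \<mu> * step_weight skip k * ((f u + g u) - (f (y k) + g (y k)))"
proof -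
  have step: "minimizer (\<lambda>u. aug_lagrangian f g \<mu> u (z' k) (l k)) (x' k)"
      "skip k \<longleftrightarrow> f (x' k) + g (x' k) > aug_lagrangian f g \<mu> (x' k) (z' k) (l k)"
      "\<not> skip k \<Longrightarrow> z k = z' k \<and> x k = x' k"
      "minimizer (\<lambda>u. Q_model f g \<mu> u (x k)) (y k)"
    using run k unfolding falm_s_run_def by auto
  note Y = prox_gradient_step[OF f_convex g_convex f_diff lip \<mu> step(4)]
  show ?thesis
  proof (cases "skip k")
    case True
    have "x k = z k"
      using run k True unfolding falm_s_run_def by (cases "k = 1") auto
    then show ?thesis
      using Y[of u] True by (simp add: step_weight_def)
  next
    case False
    have "(norm (x k - u))\<^sup>2 - (norm (z k - u))\<^sup>2 \<le> 2 * \<mu> * ((f u + g u) - (f (x k) + g (x k)))"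
      using alternating_linearization_step[OF f_convex \<mu>(1) falm_s_multiplier[OF k] step(1)]
        step(2,3) False by simp
    \<comment> \<open>The y-step inequality at \<open>u = x k\<close> shows that the objective does
      not increase from \<open>x k\<close> to \<open>y k\<close>. So when the two inequalities are
      added and the distances to \<open>x k\<close> cancel, the value at \<open>x k\<close> can be
      replaced by the value at \<open>y k\<close>.\<close>
    moreover have "0 \<le> 2 * \<mu> * ((f (x k) + g (x k)) - (f (y k) + g (y k)))"
      by (rule order_trans[OF _ Y[of "x k"]]) simp
    ultimately show ?thesis
      using Y[of u] False by (simp add: step_weight_def algebra_simps)
  qed
qed

text \<open>The potential is bounded for an arbitrary comparison point \<open>w\<close>. At
  \<open>k = 1\<close> the term in \<open>y (k - 1)\<close> has coefficient 0, and
  \<open>z 1 = x 0\<close> supplies the right-hand side.\<close>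

lemma falm_s_potential:
  assumes k: "k \<ge> 1"
  shows "2 * \<mu> * (step_weight skip k * (t k)\<^sup>2) * ((f (y k) + g (y k)) - (f w + g w))
      + (norm (t k *\<^sub>R y k - (t k - 1) *\<^sub>R y (k - 1) - w))\<^sup>2 \<le> (norm (x 0 - w))\<^sup>2"
  using k
proof (induction k rule: nat_induct_at_least)
  case base
  show ?case
    using falm_s_step[of 1 w] falm_s_first by (simp add: algebra_simps)
next
  case (Suc k)
  let ?c = "step_weight skip (Suc k)" and ?t = "t (Suc k)" and ?F = "\<lambda>u. f u + g u"
  have t: "1 \<le> ?t"
    by (rule falm_s_t_ge_1) simp
  \<comment> \<open>The extrapolation is designed for this: scaled by \<open>?t\<close>, it turns
    the \<open>z\<close> term of \<open>extrapolation_identity\<close> into the momentum vector of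
    the preceding iteration.\<close>
  have "?t *\<^sub>R z (Suc k) = ?t *\<^sub>R y k + (t k - 1) *\<^sub>R (y k - y (k - 1))"
    using t by (simp add: falm_s_momentum(2)[OF Suc.hyps] scaleR_add_right)
  then have "?t *\<^sub>R z (Suc k) - (?t - 1) *\<^sub>R y k = t k *\<^sub>R y k - (t k - 1) *\<^sub>R y (k - 1)"
    by (simp add: algebra_simps)
  then have "(norm (?t *\<^sub>R y (Suc k) - (?t - 1) *\<^sub>R y k - w))\<^sup>2
        - (norm (t k *\<^sub>R y k - (t k - 1) *\<^sub>R y (k - 1) - w))\<^sup>2
      = ?t * (?t - 1) * ((norm (y (Suc k) - y k))\<^sup>2 - (norm (z (Suc k) - y k))\<^sup>2)
        + ?t * ((norm (y (Suc k) - w))\<^sup>2 - (norm (z (Suc k) - w))\<^sup>2)"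
    by (simp add: extrapolation_identity)
  \<comment> \<open>The one-step inequality is used twice, at \<open>y k\<close> with weight
    \<open>?t * (?t - 1)\<close> and at \<open>w\<close> with weight \<open>?t\<close>.\<close>
  also have "\<dots> \<le> ?t * (?t - 1) * (2 * \<mu> * ?c * (?F (y k) - ?F (y (Suc k))))
        + ?t * (2 * \<mu> * ?c * (?F w - ?F (y (Suc k))))"
    using t by (intro add_mono mult_left_mono falm_s_step) auto
  also have "\<dots> = 2 * \<mu> * (?c * (?t * (?t - 1))) * (?F (y k) - ?F w)
        - 2 * \<mu> * (?c * ?t\<^sup>2) * (?F (y (Suc k)) - ?F w)"
    by (simp add: algebra_simps power2_eq_square)
  \<comment> \<open>With this recursion, the coefficient of the old gap matches that in the
    preceding potential, so the sum telescopes.\<close>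
  also have "?c * (?t * (?t - 1)) = step_weight skip k * (t k)\<^sup>2"
    by (rule falm_s_weight_recursion[OF Suc.hyps])
  finally show ?case
    using Suc.IH by simp
qed

lemma falm_s_rate:
  assumes k: "k \<ge> 1" and opt: "minimizer (\<lambda>u. f u + g u) w"
  shows "(f (y k) + g (y k)) - (f w + g w)
    \<le> 2 * (norm (x 0 - w))\<^sup>2 / (\<mu> * (real k + 1 + (sqrt 2 - 1) * real (r_hat skip k))\<^sup>2)"
proof -
  define v where "v = (f (y k) + g (y k)) - (f w + g w)"
  define T where "T = real k + 1 + (sqrt 2 - 1) * real (r_hat skip k)"
  \<comment> \<open>Optimality of \<open>w\<close> enters here: the sign of \<open>v\<close> is
    needed to multiply the lower bound on \<open>t\<close> by it.\<close>
  have "0 \<le> v"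
    using opt by (auto simp: is_arg_min_def v_def not_less)
  have "0 < T"
    unfolding T_def by (rule add_pos_nonneg) auto
  have "T\<^sup>2 \<le> (2 * (sqrt (step_weight skip k) * t k))\<^sup>2"
    using falm_s_t_lower_bound[OF k] \<open>0 < T\<close> by (intro power_mono) (auto simp: T_def)
  also have "\<dots> = 4 * (step_weight skip k * (t k)\<^sup>2)"
    by (simp add: power_mult_distrib step_weight_def)
  finally have "\<mu> * v * T\<^sup>2 \<le> \<mu> * v * (4 * (step_weight skip k * (t k)\<^sup>2))"
    using \<mu> \<open>0 \<le> v\<close> by (intro mult_left_mono) auto
  moreover have "2 * \<mu> * (step_weight skip k * (t k)\<^sup>2) * v \<le> (norm (x 0 - w))\<^sup>2"
    using falm_s_potential[OF k, of w] unfolding v_def by (smt (verit) zero_le_power2)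
  ultimately have "v * (\<mu> * T\<^sup>2) \<le> 2 * (norm (x 0 - w))\<^sup>2"
    by (simp add: algebra_simps)
  then show ?thesis
    using \<mu> \<open>0 < T\<close> by (simp add: v_def[symmetric] T_def[symmetric] pos_le_divide_eq)
qed

end

end

section \<open>Rate, limit of the objective values and iteration count\<close>

theorem theorem3p4:
  fixes f g F :: "real ^ 'n \<Rightarrow> real"
    and L \<mu> \<alpha> :: real
    and xs :: "real ^ 'n"
    and t' t :: "nat \<Rightarrow> real"
    and z' l x' z x y :: "nat \<Rightarrow> real ^ 'n"
    and skip :: "nat \<Rightarrow> bool"
  assumes f_convex: "convex_on UNIV f"
    and g_convex: "convex_on UNIV g"
    and F_eq: "F = (\<lambda>u. f u + g u)"
    and f_diff: "\<And>u. f differentiable (at u)"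
    and L_pos: "L > 0"
    and grad_lipschitz: "L-lipschitz_on UNIV (grad f)"
    and xs_opt: "minimizer F xs"
    and \<alpha>_eq: "\<alpha> = sqrt 2 - 1"
    and \<mu>_pos: "0 < \<mu>"
    and \<mu>_le: "\<mu> \<le> 1 / L"
    and run: "falm_s_run f g \<mu> t' z' l x' skip t z x y"
  shows "(\<forall>k\<ge>1. F (y k) - F xs
            \<le> 2 * (norm (x 0 - xs))\<^sup>2 / (\<mu> * (real k + 1 + \<alpha> * real (r_hat skip k))\<^sup>2))
       \<and> (\<lambda>k. F (y k)) \<longlonglongrightarrow> F xs
       \<and> (\<forall>\<beta>\<ge>1. 1 / (\<beta> * L) \<le> \<mu> \<longrightarrow>
            (\<forall>\<epsilon>>0. \<forall>k\<ge>1. \<lfloor>sqrt (2 * \<beta> * L * (norm (x 0 - xs))\<^sup>2 / \<epsilon>)\<rfloor> \<le> int k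
               \<longrightarrow> F (y k) - F xs \<le> \<epsilon>))"
proof (intro conjI allI impI)
  have L\<mu>: "L * \<mu> \<le> 1"
    using \<mu>_le L_pos by (simp add: field_simps)
  have opt: "F xs \<le> F u" for u
    using xs_opt by (auto simp: is_arg_min_def not_less)
  show rate: "F (y k) - F xs
      \<le> 2 * (norm (x 0 - xs))\<^sup>2 / (\<mu> * (real k + 1 + \<alpha> * real (r_hat skip k))\<^sup>2)" if "1 \<le> k" for k
    using falm_s_rate[OF run f_convex g_convex f_diff grad_lipschitz \<mu>_pos L\<mu> that xs_opt[unfolded F_eq]]
    by (simp add: F_eq \<alpha>_eq)
  \<comment> \<open>Dropping the nonnegative \<open>r_hat\<close> term leaves a rate in
    \<open>k\<close> alone, enough for the limit and the iteration count.\<close>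
  have bound: "F (y k) - F xs \<le> 2 * (norm (x 0 - xs))\<^sup>2 / (\<mu> * (real k + 1)\<^sup>2)" if "1 \<le> k" for k
  proof (rule order_trans[OF rate[OF that]])
    have "0 \<le> \<alpha> * real (r_hat skip k)"
      by (simp add: \<alpha>_eq)
    then show "2 * (norm (x 0 - xs))\<^sup>2 / (\<mu> * (real k + 1 + \<alpha> * real (r_hat skip k))\<^sup>2)
        \<le> 2 * (norm (x 0 - xs))\<^sup>2 / (\<mu> * (real k + 1)\<^sup>2)"
      using \<mu>_pos by (intro divide_left_mono mult_left_mono power_mono mult_pos_pos) auto
  qed
  have "(\<lambda>k. 2 * (norm (x 0 - xs))\<^sup>2 / \<mu> * (inverse (real (Suc k)))\<^sup>2)
      \<longlonglongrightarrow> 2 * (norm (x 0 - xs))\<^sup>2 / \<mu> * 0\<^sup>2"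
    by (intro tendsto_intros LIMSEQ_inverse_real_of_nat)
  then have lim: "(\<lambda>k. 2 * (norm (x 0 - xs))\<^sup>2 / \<mu> * (inverse (real (Suc k)))\<^sup>2) \<longlonglongrightarrow> 0"
    by simp
  have "(\<lambda>k. F (y k) - F xs) \<longlonglongrightarrow> 0"
  proof (rule tendsto_sandwich[OF _ _ tendsto_const lim])
    show "\<forall>\<^sub>F k in sequentially. 0 \<le> F (y k) - F xs"
      using opt by simp
    show "\<forall>\<^sub>F k in sequentially. F (y k) - F xs
        \<le> 2 * (norm (x 0 - xs))\<^sup>2 / \<mu> * (inverse (real (Suc k)))\<^sup>2"
      using eventually_ge_at_top[of 1]
    proof eventually_elim
      case (elim k)
      then show ?case
        using bound[of k] by (simp add: divide_inverse power_inverse add.commute mult.assoc)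
    qed
  qed
  then show "(\<lambda>k. F (y k)) \<longlonglongrightarrow> F xs"
    by (rule LIM_zero_cancel)
  fix \<beta> \<epsilon> :: real and k :: nat
  assume \<beta>: "1 \<le> \<beta>" "1 / (\<beta> * L) \<le> \<mu>" and \<epsilon>: "0 < \<epsilon>" and k: "1 \<le> k"
    and floor_le: "\<lfloor>sqrt (2 * \<beta> * L * (norm (x 0 - xs))\<^sup>2 / \<epsilon>)\<rfloor> \<le> int k"
  define C where "C = 2 * \<beta> * L * (norm (x 0 - xs))\<^sup>2"
  \<comment> \<open>The \<open>k + 1\<close> in the rate absorbs the rounding down: a real number
    whose floor is at most \<open>k\<close> is below \<open>k + 1\<close>.\<close>
  have "sqrt (C / \<epsilon>) \<le> real k + 1"
    using floor_le unfolding C_def by linarith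
  then have "C / \<epsilon> \<le> (real k + 1)\<^sup>2"
    by (rule sqrt_le_D)
  have "F (y k) - F xs \<le> 2 * (norm (x 0 - xs))\<^sup>2 / (real k + 1)\<^sup>2 * (1 / \<mu>)"
    using bound[OF k] by (simp add: mult.commute)
  \<comment> \<open>The lower bound on \<open>\<mu>\<close> gives
    \<open>1 / \<mu> \<le> \<beta> * L\<close>, the factor that appears in \<open>C\<close>.\<close>
  also have "\<dots> \<le> 2 * (norm (x 0 - xs))\<^sup>2 / (real k + 1)\<^sup>2 * (\<beta> * L)"
    using \<beta> L_pos \<mu>_pos by (intro mult_left_mono) (auto simp: field_simps)
  also have "\<dots> = C / (real k + 1)\<^sup>2"
    by (simp add: C_def)
  also have "\<dots> \<le> \<epsilon>"
    using \<open>C / \<epsilon> \<le> (real k + 1)\<^sup>2\<close> \<epsilon> by (simp add: field_simps)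
  finally show "F (y k) - F xs \<le> \<epsilon>" .
qed

end
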